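(* Let $X$ be a minimal shift space on a finite alphabet $A$ with an ergodic measure $\mu$ and $\varphi\colon A^*\to G$ a (monoid) morphism onto a finite group $G$ with uniform probability measure $\nu$. If there exists a cobounding map $\alpha\colon X\to G$ mod $1$ (that is, modulo the trivial subgroup), then the product measure $\nu\times\mu$ is ergodic on $Y_\alpha=\{(g,x)\in G\times X\mid \alpha(x)=g\}$.
   Context: A shift space on a finite alphabet $A$ is a nonempty closed subset $X\subseteq A^{\mathbb Z}$ invariant under the shift map $S((x_n)_n)=(x_{n+1})_n$, such that every letter of $A$ occurs in some element of $X$; it is minimal if it has no proper nonempty closed shift-invariant subset. An ergodic measure on $X$ is a shift-invariant ergodic Borel probability measure. The skew product $G\rtimes_\varphi X$ is the dynamical system $(G\times X,T_\varphi)$, $G$ discrete, with $T_\varphi(g,x)=(g\varphi(x_0),Sx)$. A cobounding map for $\varphi$ on $X$ modulo the trivial subgroup is a continuous map $\alpha\colon X\to G$ with $\alpha(Sx)=\alpha(x)\varphi(x_0)$ for all $x\in X$. The set $Y_\alpha$ is a closed $T_\varphi$-invariant subset of positive $\nu\times\mu$-measure; "$\nu\times\mu$ is ergodic on $Y_\alpha$" means that the normalized restriction of $\nu\times\mu$ to $Y_\alpha$ is ergodic for $T_\varphi$. *)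

theory Defs
  imports "HOL-Probability.Probability" "HOL-Algebra.Group"
begin

definition full_shift :: "'a set \<Rightarrow> (int \<Rightarrow> 'a) topology" where
  "full_shift A = product_topology (\<lambda>_. discrete_topology A) UNIV"

definition shift_map :: "(int \<Rightarrow> 'a) \<Rightarrow> int \<Rightarrow> 'a" where
  "shift_map x = (\<lambda>n. x (n + 1))"

definition shift_space :: "'a set \<Rightarrow> (int \<Rightarrow> 'a) set \<Rightarrow> bool" where
  "shift_space A X \<longleftrightarrow> finite A \<and> X \<noteq> {} \<and> closedin (full_shift A) X \<and> shift_map ` X = X
     \<and> (\<forall>a\<in>A. \<exists>x\<in>X. \<exists>n. x n = a)"

definition minimal_shift_space :: "'a set \<Rightarrow> (int \<Rightarrow> 'a) set \<Rightarrow> bool" where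
  "minimal_shift_space A X \<longleftrightarrow> shift_space A X
     \<and> (\<forall>Z. Z \<subseteq> X \<and> Z \<noteq> {} \<and> closedin (full_shift A) Z \<and> shift_map ` Z = Z \<longrightarrow> Z = X)"

definition topology_borel :: "'b topology \<Rightarrow> 'b measure" where
  "topology_borel T = sigma (topspace T) {U. openin T U}"

definition ergodic_measure :: "'b measure \<Rightarrow> ('b \<Rightarrow> 'b) \<Rightarrow> bool" where
  "ergodic_measure M T \<longleftrightarrow> prob_space M
     \<and> T \<in> measurable M M
     \<and> (\<forall>B\<in>sets M. emeasure M (T -` B \<inter> space M) = emeasure M B)
     \<and> (\<forall>B\<in>sets M. T -` B \<inter> space M = B \<longrightarrow> emeasure M B = 0 \<or> emeasure M B = 1)"

definition ergodic_measure_on_shift ::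
    "'a set \<Rightarrow> (int \<Rightarrow> 'a) set \<Rightarrow> (int \<Rightarrow> 'a) measure \<Rightarrow> bool" where
  "ergodic_measure_on_shift A X \<mu> \<longleftrightarrow>
     space \<mu> = X \<and> sets \<mu> = sets (topology_borel (subtopology (full_shift A) X))
     \<and> ergodic_measure \<mu> shift_map"

definition free_monoid :: "'a set \<Rightarrow> 'a list monoid" where
  "free_monoid A = \<lparr>carrier = lists A, mult = (@), one = []\<rparr>"

text \<open>The library's \<^const>\<open>hom\<close> only asks for compatibility with the product, hence the
  explicit condition on the neutral element.\<close>

definition monoid_morphism_onto ::
    "('a, 'm) monoid_scheme \<Rightarrow> ('b, 'n) monoid_scheme \<Rightarrow> ('a \<Rightarrow> 'b) \<Rightarrow> bool" where
  "monoid_morphism_onto M N h \<longleftrightarrow> h \<in> epi M N \<and> h \<one>\<^bsub>M\<^esub> = \<one>\<^bsub>N\<^esub>"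

definition skew_product_map ::
    "('g, 'm) monoid_scheme \<Rightarrow> ('a list \<Rightarrow> 'g) \<Rightarrow> 'g \<times> (int \<Rightarrow> 'a) \<Rightarrow> 'g \<times> (int \<Rightarrow> 'a)" where
  "skew_product_map G \<phi> = (\<lambda>(g, x). (g \<otimes>\<^bsub>G\<^esub> \<phi> [x 0], shift_map x))"

definition cobounding_map_mod_trivial ::
    "'a set \<Rightarrow> (int \<Rightarrow> 'a) set \<Rightarrow> ('g, 'm) monoid_scheme \<Rightarrow> ('a list \<Rightarrow> 'g)
      \<Rightarrow> ((int \<Rightarrow> 'a) \<Rightarrow> 'g) \<Rightarrow> bool" where
  "cobounding_map_mod_trivial A X G \<phi> \<alpha> \<longleftrightarrow>
     continuous_map (subtopology (full_shift A) X) (discrete_topology (carrier G)) \<alpha>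
     \<and> (\<forall>x\<in>X. \<alpha> (shift_map x) = \<alpha> x \<otimes>\<^bsub>G\<^esub> \<phi> [x 0])"

definition cobounding_graph ::
    "('g, 'm) monoid_scheme \<Rightarrow> (int \<Rightarrow> 'a) set \<Rightarrow> ((int \<Rightarrow> 'a) \<Rightarrow> 'g)
      \<Rightarrow> ('g \<times> (int \<Rightarrow> 'a)) set" where
  "cobounding_graph G X \<alpha> = {(g, x) \<in> carrier G \<times> X. \<alpha> x = g}"

definition normalized_restriction :: "'b measure \<Rightarrow> 'b set \<Rightarrow> 'b measure" where
  "normalized_restriction M Y = scale_measure (1 / emeasure M Y) (restrict_space M Y)"

text \<open>If \<open>Y\<close> is not mapped into itself by \<open>T\<close>, or is null, the right-hand side is false: the
  normalized restriction lives on \<open>Y\<close> and has to be a \<open>T\<close>-invariant probability measure there.\<close>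

definition ergodic_on :: "'b measure \<Rightarrow> ('b \<Rightarrow> 'b) \<Rightarrow> 'b set \<Rightarrow> bool" where
  "ergodic_on M T Y \<longleftrightarrow> ergodic_measure (normalized_restriction M Y) T"

end

theory Submission imports Defs begin

text \<open>The map \<open>j x = (\<alpha> x, x)\<close> carries the shift on \<open>X\<close> to the skew product on \<open>Y\<^sub>\<alpha>\<close> by the cobounding
  equation, and it pushes \<open>\<mu>\<close> forward to the normalized restriction of \<open>\<nu> \<times> \<mu>\<close>, since every fibre of
  \<open>Y\<^sub>\<alpha>\<close> over \<open>X\<close> is a single point of \<open>\<nu>\<close>-mass \<open>1 / |G|\<close>. Ergodicity passes to factors.\<close>

text \<open>Pulling back along \<open>j\<close> turns \<open>T\<close>-invariant sets into
  \<open>S\<close>-invariant sets of the same mass. The measure of \<open>N\<close> is prescribed by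
  an equation on its sets instead of by \<open>distr\<close>, so that the lemma applies directly to
  a normalized restriction.\<close>

lemma ergodic_measure_factor:
  assumes erg: "ergodic_measure M S"
    and j: "j \<in> measurable M N"
    and emeasure_N: "\<And>B. B \<in> sets N \<Longrightarrow> emeasure N B = emeasure M (j -` B \<inter> space M)"
    and T: "T \<in> measurable N N"
    and equivariant: "\<And>x. x \<in> space M \<Longrightarrow> T (j x) = j (S x)"
  shows "ergodic_measure N T"
proof -
  have prob: "prob_space M" and S: "S \<in> measurable M M"
    and inv: "\<And>B. B \<in> sets M \<Longrightarrow> emeasure M (S -` B \<inter> space M) = emeasure M B"
    and triv: "\<And>B. B \<in> sets M \<Longrightarrow> S -` B \<inter> space M = B \<Longrightarrow> emeasure M B = 0 \<or> emeasure M B = 1"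
    using erg unfolding ergodic_measure_def by auto
  have jN: "\<And>x. x \<in> space M \<Longrightarrow> j x \<in> space N" and SM: "\<And>x. x \<in> space M \<Longrightarrow> S x \<in> space M"
    using j S by (auto dest: measurable_space)
  \<comment> \<open>Equivariance at the level of sets: both the invariance of \<open>N\<close> and
    the zero-one law are carried over through this identity.\<close>
  have pre: "j -` (T -` B \<inter> space N) \<inter> space M = S -` (j -` B \<inter> space M) \<inter> space M" for B
    using jN SM by (auto simp: equivariant)
  have "j -` space N \<inter> space M = space M"
    using jN by auto
  then have "emeasure N (space N) = 1"
    by (simp add: emeasure_N prob_space.emeasure_space_1[OF prob])
  then have "prob_space N"
    by (rule prob_spaceI)
  moreover have "emeasure N (T -` B \<inter> space N) = emeasure N B" if B: "B \<in> sets N" for B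
    using measurable_sets[OF T B] measurable_sets[OF j B] B by (simp add: emeasure_N pre inv del: vimage_Int)
  \<comment> \<open>For invariant \<open>B\<close>, \<open>pre\<close> says that the pullback of
    \<open>B\<close> under \<open>j\<close> is fixed by \<open>S\<close>, so the zero-one law of
    \<open>M\<close> decides its mass.\<close>
  moreover have "emeasure N B = 0 \<or> emeasure N B = 1"
    if B: "B \<in> sets N" and eq: "T -` B \<inter> space N = B" for B
    using triv[OF measurable_sets[OF j B]] pre[of B, unfolded eq] B by (simp add: emeasure_N del: vimage_Int)
  ultimately show ?thesis
    using T unfolding ergodic_measure_def by blast
qed

text \<open>Every subset of a discrete space is open, so its preimage is open and thus a generator
  of the Borel sigma-algebra.\<close>

lemma continuous_map_discrete_measurable:
  assumes cont: "continuous_map T (discrete_topology C) f"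
    and sp: "space M = topspace T" and sets: "sets M = sets (topology_borel T)"
  shows "f \<in> measurable M (count_space C)"
proof (rule measurableI)
  show "f x \<in> space (count_space C)" if "x \<in> space M" for x
    using that cont sp by (auto simp: continuous_map_def)
  show "f -` B \<inter> space M \<in> sets M" if "B \<in> sets (count_space C)" for B
  proof -
    have "openin T {x \<in> topspace T. f x \<in> B}"
      using that cont by (auto simp: continuous_map_def)
    moreover have "f -` B \<inter> space M = {x \<in> topspace T. f x \<in> B}"
      using sp by auto
    \<comment> \<open>\<open>sigma\<close> gives the generated sigma-algebra only if the generators
      are subsets of the space.\<close>
    moreover have "{U. openin T U} \<subseteq> Pow (topspace T)"
      by (auto dest: openin_subset)
    ultimately show ?thesis
      by (simp add: sets topology_borel_def sets_measure_of sigma_sets.Basic)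
  qed
qed

text \<open>As \<open>G\<close> is finite, the graph is a finite union of measurable rectangles, one
  for each value of \<alpha>.\<close>

lemma cobounding_graph_in_sets:
  assumes C: "finite (carrier G)" and sp: "space M = X"
    and f: "\<alpha> \<in> measurable M (count_space (carrier G))"
  shows "cobounding_graph G X \<alpha> \<in> sets (uniform_count_measure (carrier G) \<Otimes>\<^sub>M M)"
proof -
  have "cobounding_graph G X \<alpha> = (\<Union>g\<in>carrier G. {g} \<times> (\<alpha> -` {g} \<inter> space M))"
    using sp by (auto simp: cobounding_graph_def)
  also have "\<dots> \<in> sets (uniform_count_measure (carrier G) \<Otimes>\<^sub>M M)"
    using measurable_sets[OF f] C
    by (intro sets.finite_UN pair_measureI) (auto simp: sets_uniform_count_measure)
  finally show ?thesis .
qed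

text \<open>By Fubini: over each point of \<open>X\<close>, a subset of the graph has at most one
  point, which has mass \<open>1 / card (carrier G)\<close>.\<close>

lemma emeasure_subset_cobounding_graph:
  assumes C: "finite (carrier G)" and M: "sigma_finite_measure M" and sp: "space M = X"
    and f: "\<alpha> \<in> measurable M (count_space (carrier G))"
    and B: "B \<in> sets (uniform_count_measure (carrier G) \<Otimes>\<^sub>M M)"
    and sub: "B \<subseteq> cobounding_graph G X \<alpha>"
  shows "emeasure (uniform_count_measure (carrier G) \<Otimes>\<^sub>M M) B
    = ennreal (1 / card (carrier G)) * emeasure M ((\<lambda>x. (\<alpha> x, x)) -` B \<inter> space M)"
proof -
  let ?U = "uniform_count_measure (carrier G)"
  have fU: "\<alpha> \<in> measurable M ?U"
    using f by (simp cong: measurable_cong_sets add: sets_uniform_count_measure_count_space)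
  have j: "(\<lambda>x. (\<alpha> x, x)) \<in> measurable M (?U \<Otimes>\<^sub>M M)"
    using fU by simp
  interpret M: sigma_finite_measure M by (rule M)
  have "finite_measure ?U"
    by (rule finite_measureI) (use C in \<open>simp add: emeasure_uniform_count_measure space_uniform_count_measure\<close>)
  then interpret U: sigma_finite_measure ?U
    by (rule finite_measure.sigma_finite_measure)
  interpret pair_sigma_finite ?U M ..
  \<comment> \<open>The variant slicing at a fixed second coordinate is used, since these are the
    slices with at most one point.\<close>
  have "emeasure (?U \<Otimes>\<^sub>M M) B = (\<integral>\<^sup>+y. emeasure ?U ((\<lambda>x. (x, y)) -` B) \<partial>M)"
    by (rule emeasure_pair_measure_alt2[OF B])
  also have "\<dots> = (\<integral>\<^sup>+y. ennreal (1 / card (carrier G)) * indicator ((\<lambda>x. (\<alpha> x, x)) -` B \<inter> space M) y \<partial>M)"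
  proof (rule nn_integral_cong)
    fix y assume y: "y \<in> space M"
    have "\<alpha> y \<in> carrier G"
      using measurable_space[OF f y] by simp
    moreover have "(\<lambda>x. (x, y)) -` B = (if (\<alpha> y, y) \<in> B then {\<alpha> y} else {})"
      using sub by (auto simp: cobounding_graph_def)
    ultimately show "emeasure ?U ((\<lambda>x. (x, y)) -` B)
        = ennreal (1 / card (carrier G)) * indicator ((\<lambda>x. (\<alpha> x, x)) -` B \<inter> space M) y"
      using C y by (simp add: emeasure_uniform_count_measure indicator_def)
  qed
  also have "\<dots> = ennreal (1 / card (carrier G)) * emeasure M ((\<lambda>x. (\<alpha> x, x)) -` B \<inter> space M)"
    by (rule nn_integral_cmult_indicator[OF measurable_sets[OF j B]])
  finally show ?thesis .
qed

theorem proposition7p10: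
  fixes A :: "'a set" and X :: "(int \<Rightarrow> 'a) set" and \<mu> :: "(int \<Rightarrow> 'a) measure"
    and G :: "('g, 'm) monoid_scheme" and \<phi> :: "'a list \<Rightarrow> 'g" and \<alpha> :: "(int \<Rightarrow> 'a) \<Rightarrow> 'g"
  assumes "finite A" and "minimal_shift_space A X"
    and "ergodic_measure_on_shift A X \<mu>"
    and "group G" and "finite (carrier G)"
    and "monoid_morphism_onto (free_monoid A) G \<phi>"
    and "cobounding_map_mod_trivial A X G \<phi> \<alpha>"
  shows "ergodic_on (uniform_count_measure (carrier G) \<Otimes>\<^sub>M \<mu>) (skew_product_map G \<phi>)
           (cobounding_graph G X \<alpha>)"
proof -
  define P where "P = uniform_count_measure (carrier G) \<Otimes>\<^sub>M \<mu>"
  define Y where "Y = cobounding_graph G X \<alpha>"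
  define N where "N = normalized_restriction P Y"
  define j where "j = (\<lambda>x. (\<alpha> x, x))"
  have sp: "space \<mu> = X" and sets: "sets \<mu> = sets (topology_borel (subtopology (full_shift A) X))"
    and erg: "ergodic_measure \<mu> shift_map"
    using assms(3) by (auto simp: ergodic_measure_on_shift_def)
  have cont: "continuous_map (subtopology (full_shift A) X) (discrete_topology (carrier G)) \<alpha>"
    and cob: "\<And>x. x \<in> X \<Longrightarrow> \<alpha> (shift_map x) = \<alpha> x \<otimes>\<^bsub>G\<^esub> \<phi> [x 0]"
    using assms(7) by (auto simp: cobounding_map_mod_trivial_def)
  have S: "shift_map \<in> measurable \<mu> \<mu>" and prob: "prob_space \<mu>"
    using erg by (auto simp: ergodic_measure_def)
  \<comment> \<open>The topspace of a subtopology is an intersection; this inclusion makes it equal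
    to \<open>X\<close>.\<close>
  have "X \<subseteq> topspace (full_shift A)"
    using assms(2) by (simp add: minimal_shift_space_def shift_space_def closedin_subset)
  then have "space \<mu> = topspace (subtopology (full_shift A) X)"
    using sp by auto
  then have \<alpha>: "\<alpha> \<in> measurable \<mu> (count_space (carrier G))"
    by (rule continuous_map_discrete_measurable[OF cont _ sets])
  have Y: "Y \<in> sets P"
    unfolding Y_def P_def by (rule cobounding_graph_in_sets[OF assms(5) sp \<alpha>])
  have jP: "j \<in> measurable \<mu> P"
    using \<alpha> unfolding j_def P_def
    by (intro measurable_Pair) (simp_all cong: measurable_cong_sets add: sets_uniform_count_measure_count_space)
  have jY: "j x \<in> Y" if "x \<in> X" for x
    using that measurable_space[OF \<alpha>] sp by (auto simp: j_def Y_def cobounding_graph_def)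
  have sets_N: "sets N = sets (restrict_space P Y)"
    by (simp add: N_def normalized_restriction_def)
  have space_N: "space N = Y"
    using sets.sets_into_space[OF Y] sets_eq_imp_space_eq[OF sets_N] by (auto simp: space_restrict_space)
  have emeasure_P: "emeasure P B = ennreal (1 / card (carrier G)) * emeasure \<mu> (j -` B \<inter> space \<mu>)"
    if "B \<in> sets P" "B \<subseteq> Y" for B
    using emeasure_subset_cobounding_graph[OF assms(5) _ sp \<alpha>] that prob
    unfolding P_def Y_def j_def
    by (simp add: prob_space_def finite_measure.sigma_finite_measure)
  have "j -` Y \<inter> space \<mu> = space \<mu>"
    using jY sp by auto
  then have emeasure_Y: "emeasure P Y = ennreal (1 / card (carrier G))"
    using emeasure_P[OF Y] by (simp add: prob_space.emeasure_space_1[OF prob])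
  \<comment> \<open>The neutral element keeps \<open>1 / card (carrier G)\<close> away from the
    default value \<open>1 / 0 = 0\<close>, for which the cancellation below would fail.\<close>
  have "card (carrier G) > 0"
    using assms(4,5) by (auto simp: card_gt_0_iff dest: group.is_monoid monoid.one_closed)
  then have cancel: "1 / emeasure P Y * ennreal (1 / card (carrier G)) = 1"
    by (simp add: emeasure_Y divide_ennreal flip: ennreal_1 ennreal_mult)
  \<comment> \<open>Normalizing removes exactly the factor \<open>1 / card (carrier G)\<close>, so
    \<open>N\<close> is the image of \<mu> under \<open>j\<close>.\<close>
  have emeasure_N: "emeasure N B = emeasure \<mu> (j -` B \<inter> space \<mu>)" if "B \<in> sets N" for B
  proof -
    have B: "B \<in> sets P" "B \<subseteq> Y"
      using that Y by (auto simp: sets_N sets_restrict_space_iff)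
    have "emeasure N B = 1 / emeasure P Y * emeasure P B"
      using B Y by (simp add: N_def normalized_restriction_def emeasure_restrict_space)
    then show ?thesis
      by (simp add: emeasure_P[OF B] cancel flip: mult.assoc)
  qed
  have j: "j \<in> measurable \<mu> N"
    unfolding measurable_cong_sets[OF refl sets_N]
    using jP jY sp by (intro measurable_restrict_space2) auto
  \<comment> \<open>A point of \<open>Y\<close> is determined by its second coordinate, and the
    cobounding equation makes the skew product on \<open>Y\<close> equal to \<open>snd\<close>, then
    the shift, then \<open>j\<close>. Each factor is measurable, and since \<open>j\<close> ends in
    \<open>Y\<close>, the invariance of \<open>Y\<close> comes with it.\<close>
  have "snd \<in> measurable N \<mu>"
    unfolding measurable_cong_sets[OF sets_N refl] P_def
    by (intro measurable_restrict_space1 measurable_snd)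
  then have "(\<lambda>p. j (shift_map (snd p))) \<in> measurable N N"
    by (intro measurable_compose[OF measurable_compose[OF _ S] j])
  moreover have "skew_product_map G \<phi> p = j (shift_map (snd p))" if "p \<in> space N" for p
    using that cob
    by (auto simp: space_N Y_def cobounding_graph_def skew_product_map_def j_def)
  ultimately have T: "skew_product_map G \<phi> \<in> measurable N N"
    by (simp cong: measurable_cong)
  have "ergodic_measure N (skew_product_map G \<phi>)"
    using erg j emeasure_N T
  proof (rule ergodic_measure_factor)
    show "skew_product_map G \<phi> (j x) = j (shift_map x)" if "x \<in> space \<mu>" for x
      using that cob sp by (simp add: skew_product_map_def j_def)
  qed
  then show ?thesis
    by (simp add: ergodic_on_def N_def P_def Y_def)
qed

end
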